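(* Every integer $m\ge 0$ appears at least once as a frontier value of Mem$^0$; that is, for every integer $m\ge 0$ there exists an integer $n\ge 0$ with $\mathcal{G}(n_\infty)=m$.
   Context: Mem$^0$ is an impartial game (normal play) on a heap of tokens. A position $n_k$ (integers $n,k\ge 0$) is a heap of $n$ tokens with memory $k$; from $n_k$ a player may move to $(n-j)_j$ for any integer $j$ with $1\le j\le n$ and $j\ne k$. The nim value is defined recursively by $\mathcal{G}(n_k)=\operatorname{mex}\{\mathcal{G}((n-j)_j) : 1\le j\le n,\ j\ne k\}$, where $\operatorname{mex}(S)$ is the least nonnegative integer not in $S$. For fixed $n$, the positions $n_{n+1},n_{n+2},\ldots$ all have the same options; each is denoted $n_\infty$, and $\mathcal{G}(n_\infty)$ (the common value of $\mathcal{G}(n_k)$ for $k\ge n+1$) is called the $n$th frontier value. *)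

theory Defs
  imports Main
begin

definition mex :: "nat set \<Rightarrow> nat" where
  "mex S = (LEAST m. m \<notin> S)"

text \<open>The pair \<open>(n, k)\<close> encodes the position \<open>n\<^sub>k\<close>: \<open>n\<close> tokens with memory \<open>k\<close>.\<close>

definition mem0_opts :: "nat \<times> nat \<Rightarrow> (nat \<times> nat) set" where
  "mem0_opts p = {(fst p - j, j) |j. 1 \<le> j \<and> j \<le> fst p \<and> j \<noteq> snd p}"

function mem0_nim :: "nat \<times> nat \<Rightarrow> nat" where
  "mem0_nim p = mex (mem0_nim ` mem0_opts p)"
  by auto
termination
  by (relation "measure fst") (auto simp: mem0_opts_def)

declare mem0_nim.simps [simp del]

lemma mem0_nim_eq:
  "mem0_nim (n, k) = mex {mem0_nim (n - j, j) |j. 1 \<le> j \<and> j \<le> n \<and> j \<noteq> k}"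
proof -
  have "mem0_nim ` mem0_opts (n, k) = {mem0_nim (n - j, j) |j. 1 \<le> j \<and> j \<le> n \<and> j \<noteq> k}"
    by (auto simp: mem0_opts_def)
  then show ?thesis
    by (simp add: mem0_nim.simps [of "(n, k)"])
qed

text \<open>The frontier value is the common nim value of the positions \<open>(n, k)\<close> with \<open>k \<ge> n + 1\<close>;
  we take \<open>k = n + 1\<close> as the representative, justified by \<open>mem0_nim_frontier\<close>.\<close>

definition mem0_frontier :: "nat \<Rightarrow> nat" where
  "mem0_frontier n = mem0_nim (n, n + 1)"

lemma mem0_opts_frontier:
  assumes "n + 1 \<le> k"
  shows "mem0_opts (n, k) = mem0_opts (n, n + 1)"
  using assms by (auto simp: mem0_opts_def)

lemma mem0_nim_frontier:
  assumes "n + 1 \<le> k"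
  shows "mem0_nim (n, k) = mem0_frontier n"
  by (simp only: mem0_frontier_def mem0_nim.simps [of "(n, k)"]
      mem0_nim.simps [of "(n, n + 1)"] mem0_opts_frontier [OF assms])

end

theory Submission
  imports Defs "HOL-Library.Infinite_Set"
begin

text \<open>
  The proof combines two observations about frontier values with the defining property of mex.

  First, the memory can lower the value of a heap only by removing the unique option of some value.
  If the value \<open>v\<close> of \<open>n\<^sub>k\<close> differs from the frontier value of \<open>n\<close>, then the forbidden move
  leads to \<open>(n - k)\<^sub>k\<close>, and that position must itself have value \<open>v\<close>. Repeating the argument on
  the smaller heap cannot go on forever, so it ends at a heap whose frontier value is \<open>v\<close>: every
  nim value is a frontier value (\<open>mem0_nim_is_frontier\<close>). As a frontier position of value \<open>v\<close> has
  options of all values below \<open>v\<close>, the set of frontier values is downward closed.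

  Second, taking more than half of a heap leaves a frontier position, because the memory then exceeds
  what remains. Hence heaps with \<open>2 * i < n\<close> have different frontier values
  (\<open>mem0_frontier_neq\<close>), and the heaps \<open>3 ^ i\<close> provide infinitely many of them. A downward closed
  infinite set of natural numbers contains every natural number.
\<close>

lemma mex_notin:
  assumes "finite S"
  shows "mex S \<notin> S"
  using ex_new_if_finite[OF infinite_UNIV_nat assms] unfolding mex_def by (rule LeastI_ex)

lemma less_mex_in: "x < mex S \<Longrightarrow> x \<in> S"
  unfolding mex_def using not_less_Least by blast

lemma mex_eqI:
  assumes "v \<notin> S" and "\<And>x. x < v \<Longrightarrow> x \<in> S"
  shows "mex S = v"
  unfolding mex_def using assms by (intro Least_equality) (auto simp: not_less[symmetric])

lemma finite_mem0_opts: "finite (mem0_opts p)"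
proof -
  have "mem0_opts p \<subseteq> (\<lambda>j. (fst p - j, j)) ` {..fst p}"
    by (auto simp: mem0_opts_def)
  then show ?thesis
    by (rule finite_subset) simp
qed

lemma mem0_nim_neq_option:
  assumes "q \<in> mem0_opts p"
  shows "mem0_nim q \<noteq> mem0_nim p"
  using mex_notin[OF finite_imageI[OF finite_mem0_opts]] assms
  by (metis imageI mem0_nim.simps)

lemma mem0_nim_less_option:
  assumes "x < mem0_nim p"
  shows "\<exists>q \<in> mem0_opts p. mem0_nim q = x"
  using assms less_mex_in unfolding mem0_nim.simps[of p] by fastforce

text \<open>Going from memory \<open>n + 1\<close> to memory \<open>k\<close> deletes at most the option \<open>(n - k)\<^sub>k\<close>. The deletion
  changes the mex only if the deleted value was attained nowhere else, and it then becomes the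
  new mex.\<close>

lemma mem0_nim_neq_frontier:
  assumes "mem0_nim (n, k) \<noteq> mem0_frontier n"
  shows "1 \<le> k" and "k \<le> n" and "mem0_nim (n - k, k) = mem0_nim (n, k)"
proof -
  let ?v = "mem0_nim (n, k)"
  have sub: "mem0_opts (n, k) \<subseteq> mem0_opts (n, n + 1)"
    by (auto simp: mem0_opts_def)
  have "?v \<in> mem0_nim ` mem0_opts (n, n + 1)"
  proof (rule ccontr)
    assume "?v \<notin> mem0_nim ` mem0_opts (n, n + 1)"
    then have "mex (mem0_nim ` mem0_opts (n, n + 1)) = ?v"
      using mem0_nim_less_option[of _ "(n, k)"] sub by (intro mex_eqI) blast+
    then show False
      using assms by (metis mem0_frontier_def mem0_nim.simps)
  qed
  then obtain j where j: "1 \<le> j" "j \<le> n" "mem0_nim (n - j, j) = ?v"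
    by (auto simp: mem0_opts_def)
  have "j = k"
    using mem0_nim_neq_option[of "(n - j, j)" "(n, k)"] j by (auto simp: mem0_opts_def)
  then show "1 \<le> k" "k \<le> n" "mem0_nim (n - k, k) = ?v"
    using j by auto
qed

lemma mem0_nim_is_frontier: "\<exists>n'. mem0_frontier n' = mem0_nim (n, k)"
proof (induction n rule: less_induct)
  case (less n)
  show ?case
  proof (cases "mem0_nim (n, k) = mem0_frontier n")
    case True
    then show ?thesis by auto
  next
    case False
    note step = mem0_nim_neq_frontier[OF False]
    then have "n - k < n" by simp
    then show ?thesis
      using less.IH[of "n - k"] step(3) by simp
  qed
qed

text \<open>Removing \<open>n - i\<close> tokens from \<open>n\<close> leaves \<open>i\<close> tokens with memory \<open>n - i > i\<close>, a frontier
  position, as an option of the frontier position of \<open>n\<close>.\<close>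

lemma mem0_frontier_neq:
  assumes "2 * i < n"
  shows "mem0_frontier i \<noteq> mem0_frontier n"
proof -
  have "(i, n - i) \<in> mem0_opts (n, n + 1)"
    using assms by (auto simp: mem0_opts_def intro!: exI[of _ "n - i"])
  then have "mem0_nim (i, n - i) \<noteq> mem0_frontier n"
    unfolding mem0_frontier_def by (rule mem0_nim_neq_option)
  then show ?thesis
    using assms by (simp add: mem0_nim_frontier)
qed

lemma infinite_range_mem0_frontier: "infinite (range mem0_frontier)"
proof -
  have neq: "mem0_frontier (3 ^ a) \<noteq> mem0_frontier (3 ^ b)" if "a < b" for a b :: nat
  proof (rule mem0_frontier_neq)
    have "2 * 3 ^ a < (3::nat) ^ Suc a" by simp
    also have "\<dots> \<le> 3 ^ b"
      using that by (intro power_increasing) auto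
    finally show "2 * 3 ^ a < (3::nat) ^ b" .
  qed
  have "inj (\<lambda>a. mem0_frontier (3 ^ a))"
    by (rule injI) (metis neq linorder_neqE_nat)
  then have "infinite (range (\<lambda>a. mem0_frontier (3 ^ a)))"
    by (rule range_inj_infinite)
  then show ?thesis
    by (rule contrapos_nn) (auto elim: finite_subset[rotated])
qed

theorem theorem5p2:
  shows "\<forall>m::nat. \<exists>n::nat. mem0_frontier n = m"
proof
  fix m :: nat
  obtain n where "m < mem0_frontier n"
    using infinite_range_mem0_frontier unfolding infinite_nat_iff_unbounded by auto
  then obtain i k where "mem0_nim (i, k) = m"
    using mem0_nim_less_option unfolding mem0_frontier_def by fast
  then show "\<exists>n. mem0_frontier n = m"
    using mem0_nim_is_frontier by metis
qed

end
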